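(* Let $(\mu_k,L_k,T_k)_{0\le k<N+1}$ together with distinguished solutions $f_{k,h_k}$ satisfy the Standing Assumption described in the context. Suppose that there are constants $\alpha_j\in\mathbb{R}$, $0\le j<N+1$, such that $T_jf=\alpha_jf'$ holds for all $0\le j<N+1$. Let $1\le n<N+1$, let $h\in C_b^n(\mathbb{R})$ with $\mu_0(h)=0$, and write $f:=f_{0,h}$. Put $a_j:=\big|\sum_{i=0}^j\alpha_i\big|$ for $0\le j<N+1$. (i) If there exist constants $C_l$, $0\le l<N+1$, such that $\|f_{l,h_l}'\|\le C_l\|h_l\|$ for each $0\le l<N+1$ and each $h_l$ with $\mu_l(h_l)=0$, then $$\|f^{(n)}\|\le C_{n-1}\sum_{j=0}^{n-1}\Big(\prod_{i=j}^{n-2}C_ia_i\Big)\|h^{(j)}\|.$$ (ii) If there exist constants $D_l$, $0\le l<N+1$, such that $\|f_{l,h_l}''\|\le D_l\|h_l\|$ for each $0\le l<N+1$ and each $h_l$ with $\mu_l(h_l)=0$, then, if $n=2k+1\ge1$, $$\|f^{(2k+1)}\|\le D_{2k-1}\sum_{j=1}^k\Big(\prod_{i=j}^{k-1}D_{2i-1}a_{2i}\Big)\|h^{(2j-1)}\|+\|f'\|\prod_{i=1}^kD_{2i-1}a_{2i-2},$$ and, if $n=2k\ge2$, $$\|f^{(2k)}\|\le D_{2k-2}\sum_{j=0}^{k-1}\Big(\prod_{i=j}^{k-2}D_{2i}a_{2i+1}\Big)\|h^{(2j)}\|.$$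
   Context: Notation. $\|\cdot\|$ is the supremum norm. $h\in C_b^n(\mathbb{R})$ means that $h^{(n-1)}$ exists and is absolutely continuous, with derivatives of $h$ up to order $n$ bounded; $h^{(0)}=h$. For a measure $\mu$, $\mu(h)=\int h\,d\mu$; $h$ is centred with respect to $\mu$ if $\mu(h)=0$. Empty products equal $1$ and empty sums (including any prefactor with an undefined negative index, as for $k=0$) equal $0$. Standing Assumption. Fix $N\in\mathbb{N}\cup\{\infty\}$ and an order $p\in\mathbb{N}$. For $0\le k<N+1$ we are given a probability measure $\mu_k$ on $(\mathbb{R},\mathcal{B})$ and linear differential operators $$L_kf(x)=\sum_{j=0}^{p}a_{k,j}(x)f^{(j)}(x),\qquad T_kf(x)=\sum_{j=0}^{p}b_{k,j}(x)f^{(j)}(x),$$ where the leading coefficient $a_{k,p}$ does not depend on $k$ (the coefficient functions $a_{k,j}(x)$ are not to be confused with the constants $a_j$ of the claim). $L_k$ is characterizing for $\mu_k$: a random variable $X$ has law $\mu_k$ if and only if $\mathbb{E}[L_kf(X)]=0$ for all sufficiently smooth $f$. The operators are linked by $$\frac{d}{dx}L_kf(x)=L_{k+1}f'(x)-T_kf(x)\qquad\text{whenever } k+1<N+1.$$ For each $0\le k<N+1$ and each function $h_k$ with $\mu_k(h_k)=0$ there is a distinguished solution $f_{k,h_k}$ (a fixed, unambiguous choice of solution) of the Stein equation $L_kf=h_k$. Moreover, whenever $k+1<N+1$ (and $h_k$ is differentiable, so that the expression makes sense), the function $h_{k+1}:=h_k'+T_kf_{k,h_k}$ is integrable and centred with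 respect to $\mu_{k+1}$, and $f_{k,h_k}'$, which solves $L_{k+1}f=h_{k+1}$, is the distinguished solution of that equation: $f_{k,h_k}'=f_{k+1,h_{k+1}}$. *)

theory Defs
  imports "HOL-Probability.Probability"
begin

definition times_differentiable :: "nat \<Rightarrow> (real \<Rightarrow> real) \<Rightarrow> bool" where
  "times_differentiable n f \<longleftrightarrow>
     (\<forall>j<n. \<forall>x. (deriv ^^ j) f field_differentiable (at x))"

(* Extended-real valued, so that it is defined for unbounded functions as well;
   in ereal, 0 * \<infinity> = 0. *)
definition sup_norm :: "(real \<Rightarrow> real) \<Rightarrow> ereal" where
  "sup_norm g = (SUP x. ereal \<bar>g x\<bar>)"

(* The intervals may be degenerate: a degenerate interval contributes 0 to both sums. *)
definition abs_cont_on_interval :: "real \<Rightarrow> real \<Rightarrow> (real \<Rightarrow> real) \<Rightarrow> bool" where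
  "abs_cont_on_interval c d g \<longleftrightarrow>
     (\<forall>\<epsilon>>0. \<exists>\<delta>>0. \<forall>(m::nat) (u :: nat \<Rightarrow> real) (v :: nat \<Rightarrow> real).
        (\<forall>i<m. c \<le> u i \<and> u i \<le> v i \<and> v i \<le> d) \<longrightarrow>
        (\<forall>i<m. \<forall>j<i. {u i<..<v i} \<inter> {u j<..<v j} = {}) \<longrightarrow>
        (\<Sum>i<m. v i - u i) < \<delta> \<longrightarrow>
        (\<Sum>i<m. \<bar>g (v i) - g (u i)\<bar>) < \<epsilon>)"

(* Absolute continuity on the real line means absolute continuity on every compact
   interval; for functions with bounded derivative, as below, this is the same as the
   global epsilon-delta condition. *)
definition abs_cont :: "(real \<Rightarrow> real) \<Rightarrow> bool" where
  "abs_cont g \<longleftrightarrow> (\<forall>c d. abs_cont_on_interval c d g)"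

(* The class C_b^n for n \<ge> 1. The n-th derivative of h exists only almost everywhere in
   general, so its boundedness is required on the set where it exists. *)
definition Cb :: "nat \<Rightarrow> (real \<Rightarrow> real) set" where
  "Cb n = {h. times_differentiable (n - 1) h \<and>
              abs_cont ((deriv ^^ (n - 1)) h) \<and>
              (\<forall>j<n. bounded (range ((deriv ^^ j) h))) \<and>
              bounded ((deriv ^^ n) h ` {x. (deriv ^^ (n - 1)) h field_differentiable (at x)})}"

definition centred :: "real measure \<Rightarrow> (real \<Rightarrow> real) \<Rightarrow> bool" where
  "centred \<mu> h \<longleftrightarrow> integrable \<mu> h \<and> (\<integral>x. h x \<partial>\<mu>) = 0"

definition diff_op :: "nat \<Rightarrow> (nat \<Rightarrow> real \<Rightarrow> real) \<Rightarrow> (real \<Rightarrow> real) \<Rightarrow> real \<Rightarrow> real" where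
  "diff_op p c f x = (\<Sum>j\<le>p. c j x * (deriv ^^ j) f x)"

definition solves :: "nat \<Rightarrow> (nat \<Rightarrow> real \<Rightarrow> real) \<Rightarrow> (real \<Rightarrow> real) \<Rightarrow> (real \<Rightarrow> real) \<Rightarrow> bool" where
  "solves p c h f \<longleftrightarrow> times_differentiable p f \<and> (\<forall>x. diff_op p c f x = h x)"

(* \<nu> ranges over the possible laws of a real random variable; F is the class of
   sufficiently smooth test functions. *)
definition characterizing ::
  "(real \<Rightarrow> real) set \<Rightarrow> nat \<Rightarrow> (nat \<Rightarrow> real \<Rightarrow> real) \<Rightarrow> real measure \<Rightarrow> bool" where
  "characterizing F p c \<mu> \<longleftrightarrow>
     (\<forall>\<nu>. prob_space \<nu> \<and> sets \<nu> = sets borel \<longrightarrow>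
        (\<nu> = \<mu> \<longleftrightarrow>
          (\<forall>f\<in>F. integrable \<nu> (diff_op p c f) \<and> (\<integral>x. diff_op p c f x \<partial>\<nu>) = 0)))"

(* a k and b k are the coefficient functions of L_k and T_k, and sol k h is the
   distinguished solution of L_k f = h.

   F k is the class of sufficiently smooth test functions for L_k.

   H k is the class of right-hand sides h of the equation L_k f = h under consideration;
   H k = UNIV is the case of all centred right-hand sides. The class is a parameter because
   solutions are p times differentiable functions solving the equation at every point, and
   such solutions need not exist for every centred h: for L f = f' - x f, for instance,
   they do not exist for an h with a jump. *)
locale stein_system =
  fixes N :: enat
    and p :: nat
    and \<mu> :: "nat \<Rightarrow> real measure"
    and a b :: "nat \<Rightarrow> nat \<Rightarrow> real \<Rightarrow> real"
    and F H :: "nat \<Rightarrow> (real \<Rightarrow> real) set"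
    and sol :: "nat \<Rightarrow> (real \<Rightarrow> real) \<Rightarrow> real \<Rightarrow> real"
  assumes prob: "\<And>k. enat k < N + 1 \<Longrightarrow> prob_space (\<mu> k)"
    and sets_eq: "\<And>k. enat k < N + 1 \<Longrightarrow> sets (\<mu> k) = sets borel"
    and leading_coeff: "\<And>k. enat k < N + 1 \<Longrightarrow> a k p = a 0 p"
    and test_smooth: "\<And>k f. enat k < N + 1 \<Longrightarrow> f \<in> F k \<Longrightarrow> times_differentiable p f"
    and charac: "\<And>k. enat k < N + 1 \<Longrightarrow> characterizing (F k) p (a k) (\<mu> k)"
    and link: "\<And>k f x. enat (k + 1) < N + 1 \<Longrightarrow> times_differentiable (p + 1) f \<Longrightarrow>
       (diff_op p (a k) f has_real_derivative
          diff_op p (a (k + 1)) (deriv f) x - diff_op p (b k) f x) (at x)"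
    and sol: "\<And>k h. enat k < N + 1 \<Longrightarrow> h \<in> H k \<Longrightarrow> centred (\<mu> k) h \<Longrightarrow>
       solves p (a k) h (sol k h)"
    and next_rhs: "\<And>k h. enat (k + 1) < N + 1 \<Longrightarrow> h \<in> H k \<Longrightarrow> centred (\<mu> k) h \<Longrightarrow>
       times_differentiable 1 h \<Longrightarrow>
       (\<lambda>x. deriv h x + diff_op p (b k) (sol k h) x) \<in> H (k + 1) \<and>
       centred (\<mu> (k + 1)) (\<lambda>x. deriv h x + diff_op p (b k) (sol k h) x)"
    and next_sol: "\<And>k h. enat (k + 1) < N + 1 \<Longrightarrow> h \<in> H k \<Longrightarrow> centred (\<mu> k) h \<Longrightarrow>
       times_differentiable 1 h \<Longrightarrow>
       deriv (sol k h) = sol (k + 1) (\<lambda>x. deriv h x + diff_op p (b k) (sol k h) x)"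

(* The m-th derivatives of all distinguished solutions exist and are bounded by
   K l times the norm of the right-hand side. The constants are taken nonnegative, which is
   automatic as soon as H l contains a nonzero bounded centred function. *)
definition solution_bound ::
  "nat \<Rightarrow> enat \<Rightarrow> (nat \<Rightarrow> real measure) \<Rightarrow> (nat \<Rightarrow> (real \<Rightarrow> real) set) \<Rightarrow>
   (nat \<Rightarrow> (real \<Rightarrow> real) \<Rightarrow> real \<Rightarrow> real) \<Rightarrow> (nat \<Rightarrow> real) \<Rightarrow> bool" where
  "solution_bound m N \<mu> H sol K \<longleftrightarrow>
     (\<forall>l. enat l < N + 1 \<longrightarrow> 0 \<le> K l \<and>
        (\<forall>h\<in>H l. centred (\<mu> l) h \<longrightarrow>
           times_differentiable m (sol l h) \<and>
           sup_norm ((deriv ^^ m) (sol l h)) \<le> ereal (K l) * sup_norm h))"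

end

theory Submission
  imports Defs
begin

text \<open>Since \<open>T\<^sub>j g = \<alpha>\<^sub>j g'\<close>, induction on \<open>k\<close> shows that \<open>f\<^sup>(\<^sup>k\<^sup>)\<close> is the distinguished solution of
  \<open>L\<^sub>k g = h\<^sub>k\<close> with \<open>h\<^sub>k = h\<^sup>(\<^sup>k\<^sup>) + (\<Sum>i<k. \<alpha>\<^sub>i) f\<^sup>(\<^sup>k\<^sup>)\<close>. A bound on the \<open>m\<close>-th derivative of
  distinguished solutions, applied at level \<open>k\<close>, thus controls \<open>f\<^sup>(\<^sup>k\<^sup>+\<^sup>m\<^sup>)\<close> by \<open>h\<^sup>(\<^sup>k\<^sup>)\<close> and \<open>f\<^sup>(\<^sup>k\<^sup>)\<close>.
  For \<open>m = 1\<close> and \<open>m = 2\<close> this is a linear recursion, which is then unrolled.\<close>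

section \<open>Supremum norm and iterated differentiability\<close>

lemma sup_norm_nonneg: "0 \<le> sup_norm g"
  unfolding sup_norm_def by (rule SUP_upper2[of undefined]) auto

text \<open>The pointwise triangle inequality suffices even for unbounded functions, because the
  norm is extended-real valued. This matters since no bound on the lower derivatives of a solution
  is known in advance.\<close>

lemma sup_norm_add_scaled:
  "sup_norm (\<lambda>x. g x + c * f x) \<le> sup_norm g + ereal \<bar>c\<bar> * sup_norm f"
  unfolding sup_norm_def
proof (rule SUP_least)
  fix x
  have "ereal \<bar>g x + c * f x\<bar> \<le> ereal \<bar>g x\<bar> + ereal \<bar>c\<bar> * ereal \<bar>f x\<bar>"
    using abs_triangle_ineq[of "g x" "c * f x"] by (simp add: abs_mult)
  also have "\<dots> \<le> (SUP x. ereal \<bar>g x\<bar>) + ereal \<bar>c\<bar> * (SUP x. ereal \<bar>f x\<bar>)"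
    by (intro add_mono ereal_mult_left_mono SUP_upper) auto
  finally show "ereal \<bar>g x + c * f x\<bar> \<le> \<dots>" .
qed

lemma times_differentiable_one:
  "times_differentiable 1 g \<longleftrightarrow> (\<forall>x. g field_differentiable (at x))"
  by (simp add: times_differentiable_def)

lemma times_differentiable_mono:
  "times_differentiable n g \<Longrightarrow> m \<le> n \<Longrightarrow> times_differentiable m g"
  by (auto simp: times_differentiable_def)

lemma times_differentiable_Suc:
  "times_differentiable (Suc n) g \<longleftrightarrow>
     times_differentiable n g \<and> (\<forall>x. (deriv ^^ n) g field_differentiable (at x))"
  by (auto simp: times_differentiable_def less_Suc_eq)

lemma times_differentiable_max:
  "times_differentiable m g \<Longrightarrow> times_differentiable n g \<Longrightarrow> times_differentiable (max m n) g"
  by (auto simp: times_differentiable_def max_def)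

section \<open>Linear recursive inequalities\<close>

text \<open>Each use of the recursion multiplies the older terms by one more pair of a
  \<open>c\<close> and a \<open>d\<close>. The initial value \<open>u 0\<close> stays in the result;
  this serves odd orders in (ii), where \<open>u 0\<close> is the norm of f'.\<close>

lemma recursion_unroll:
  fixes u x :: "nat \<Rightarrow> ereal" and c d :: "nat \<Rightarrow> real"
  assumes step: "\<And>k. Suc k \<le> K \<Longrightarrow>
      u (Suc k) \<le> ereal (c (Suc k)) * (x (Suc k) + ereal (d k) * u k)"
    and c: "\<And>k. 1 \<le> k \<Longrightarrow> k \<le> K \<Longrightarrow> 0 \<le> c k" and d: "\<And>k. k < K \<Longrightarrow> 0 \<le> d k"
    and x: "\<And>k. 0 \<le> x k" and u: "\<And>k. 0 \<le> u k"
  shows "u K \<le> ereal (c K) * (\<Sum>j\<in>{1..K}. ereal (\<Prod>i\<in>{j..<K}. c i * d i) * x j)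
           + u 0 * ereal (\<Prod>i\<in>{1..K}. c i * d (i - 1))"
  using step c d
proof (induction K)
  case 0
  then show ?case by simp
next
  case (Suc k)
  define S where "S = (\<Sum>j\<in>{1..k}. ereal (\<Prod>i\<in>{j..<k}. c i * d i) * x j)"
  define P where "P = (\<Prod>i\<in>{1..k}. c i * d (i - 1))"
  have IH: "u k \<le> ereal (c k) * S + u 0 * ereal P"
    unfolding S_def P_def using Suc by simp
  have nn: "0 \<le> c (Suc k)" "0 \<le> d k" using Suc.prems by auto
  have P: "0 \<le> P" unfolding P_def using Suc.prems by (auto intro!: prod_nonneg)
  have Q: "0 \<le> (\<Prod>i\<in>{j..<k}. c i * d i)" if "j \<in> {1..k}" for j
    using that Suc.prems by (auto intro!: prod_nonneg)
  have S: "0 \<le> S" unfolding S_def by (intro sum_nonneg) (use Q x in auto)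
  \<comment> \<open>Distributivity in \<open>ereal\<close> is applied to nonnegative summands. For
    \<open>k = 0\<close> the sign of \<open>c 0\<close> is not given, but then \<open>S\<close> is
    an empty sum.\<close>
  have cS: "0 \<le> ereal (c k) * S"
  proof (cases "k = 0")
    case True
    then show ?thesis by (simp add: S_def)
  next
    case False
    then show ?thesis using S Suc.prems(2)[of k] by auto
  qed
  \<comment> \<open>Passing to \<open>Suc k\<close> appends the factor with index \<open>k\<close>
    to every product; the new summand \<open>j = Suc k\<close> carries an empty product.\<close>
  have shift: "(\<Sum>j\<in>{1..k}. ereal (\<Prod>i\<in>{j..<Suc k}. c i * d i) * x j) = ereal (c k * d k) * S"
    unfolding S_def
  proof (subst sum_ereal_right_distrib)
    show "(\<Sum>j\<in>{1..k}. ereal (\<Prod>i\<in>{j..<Suc k}. c i * d i) * x j) =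
      (\<Sum>j\<in>{1..k}. ereal (c k * d k) * (ereal (\<Prod>i\<in>{j..<k}. c i * d i) * x j))"
    proof (rule sum.cong)
      fix j assume "j \<in> {1..k}"
      then show "ereal (\<Prod>i\<in>{j..<Suc k}. c i * d i) * x j =
        ereal (c k * d k) * (ereal (\<Prod>i\<in>{j..<k}. c i * d i) * x j)"
        by (simp only: prod.atLeastLessThan_Suc[of j k] atLeastAtMost_iff times_ereal.simps(1)[symmetric] mult_ac)
    qed simp
  qed (use Q x in auto)
  have "u (Suc k) \<le> ereal (c (Suc k)) * (x (Suc k) + ereal (d k) * u k)"
    using Suc.prems by simp
  also have "\<dots> \<le> ereal (c (Suc k)) * (x (Suc k) + ereal (d k) * (ereal (c k) * S + u 0 * ereal P))"
    by (intro ereal_mult_left_mono add_mono) (use IH nn in auto)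
  also have "\<dots> = ereal (c (Suc k)) * (x (Suc k) + ereal (c k * d k) * S)
      + u 0 * (ereal (c (Suc k) * d k * P))"
  proof -
    have "ereal (d k) * (ereal (c k) * S + u 0 * ereal P)
        = ereal (d k) * (ereal (c k) * S) + ereal (d k) * (u 0 * ereal P)"
      using cS u[of 0] P by (intro ereal_right_distrib) auto
    also have "ereal (d k) * (ereal (c k) * S) = ereal (c k * d k) * S"
      by (simp only: times_ereal.simps(1)[symmetric] mult_ac)
    finally have "x (Suc k) + ereal (d k) * (ereal (c k) * S + u 0 * ereal P)
        = (x (Suc k) + ereal (c k * d k) * S) + ereal (d k) * (u 0 * ereal P)"
      by (simp add: add.assoc)
    moreover have "0 \<le> ereal (c k * d k) * S"
      unfolding shift[symmetric]
    proof (rule sum_nonneg)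
      fix j assume "j \<in> {1..k}"
      then have "0 \<le> (\<Prod>i\<in>{j..<Suc k}. c i * d i)"
        using Suc.prems by (intro prod_nonneg) auto
      then show "0 \<le> ereal (\<Prod>i\<in>{j..<Suc k}. c i * d i) * x j" using x by simp
    qed
    then have "0 \<le> x (Suc k) + ereal (c k * d k) * S" using x by simp
    moreover have "0 \<le> ereal (d k) * (u 0 * ereal P)" using u P nn by simp
    ultimately have "ereal (c (Suc k)) * (x (Suc k) + ereal (d k) * (ereal (c k) * S + u 0 * ereal P))
      = ereal (c (Suc k)) * (x (Suc k) + ereal (c k * d k) * S)
        + ereal (c (Suc k)) * (ereal (d k) * (u 0 * ereal P))"
      by (simp add: ereal_right_distrib)
    also have "ereal (c (Suc k)) * (ereal (d k) * (u 0 * ereal P))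
        = u 0 * (ereal (c (Suc k)) * ereal (d k) * ereal P)"
      by (simp only: mult_ac)
    finally show ?thesis by simp
  qed
  also have "x (Suc k) + ereal (c k * d k) * S
      = (\<Sum>j\<in>{1..Suc k}. ereal (\<Prod>i\<in>{j..<Suc k}. c i * d i) * x j)"
    unfolding shift[symmetric] by (simp add: add.commute)
  also have "c (Suc k) * d k * P = (\<Prod>i\<in>{1..Suc k}. c i * d (i - 1))"
    unfolding P_def by simp
  finally show ?case .
qed

text \<open>Inserting the bound on \<open>u 0\<close> into \<open>recursion_unroll\<close> turns its
  last term into the missing summand \<open>j = 0\<close>. This serves (i) and the even orders in
  (ii).\<close>

lemma recursion_unroll_initial:
  fixes u x :: "nat \<Rightarrow> ereal" and c d :: "nat \<Rightarrow> real"
  assumes init: "u 0 \<le> ereal (c 0) * x 0"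
    and step: "\<And>k. Suc k \<le> K \<Longrightarrow>
      u (Suc k) \<le> ereal (c (Suc k)) * (x (Suc k) + ereal (d k) * u k)"
    and c: "\<And>k. k \<le> K \<Longrightarrow> 0 \<le> c k" and d: "\<And>k. k < K \<Longrightarrow> 0 \<le> d k"
    and x: "\<And>k. 0 \<le> x k" and u: "\<And>k. 0 \<le> u k"
  shows "u K \<le> ereal (c K) * (\<Sum>j\<in>{0..K}. ereal (\<Prod>i\<in>{j..<K}. c i * d i) * x j)"
proof -
  define P where "P = (\<Prod>i\<in>{1..K}. c i * d (i - 1))"
  define S where "S = (\<Sum>j\<in>{1..K}. ereal (\<Prod>i\<in>{j..<K}. c i * d i) * x j)"
  define R where "R = (\<Prod>i\<in>{0..<K}. c i * d i)"
  have P: "0 \<le> P" unfolding P_def using c d by (auto intro!: prod_nonneg)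
  have R: "0 \<le> R" unfolding R_def using c d by (auto intro!: prod_nonneg)
  have S: "0 \<le> S" unfolding S_def
  proof (intro sum_nonneg)
    fix j
    have "0 \<le> (\<Prod>i\<in>{j..<K}. c i * d i)" using c d by (auto intro!: prod_nonneg)
    then show "0 \<le> ereal (\<Prod>i\<in>{j..<K}. c i * d i) * x j" using x by simp
  qed
  \<comment> \<open>Both sides multiply all of \<open>c 0\<close>, ..., \<open>c K\<close> and
    \<open>d 0\<close>, ..., \<open>d (K - 1)\<close>, only grouped differently.\<close>
  have PR: "P * c 0 = c K * R"
    unfolding P_def R_def by (induction K) (simp_all add: algebra_simps)
  have "u K \<le> ereal (c K) * S + u 0 * ereal P"
    unfolding S_def P_def by (intro recursion_unroll) (use step c d x u in auto)
  also have "\<dots> \<le> ereal (c K) * S + ereal (c 0) * x 0 * ereal P"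
    by (intro add_left_mono ereal_mult_right_mono) (use init P in auto)
  also have "ereal (c 0) * x 0 * ereal P = ereal (P * c 0) * x 0"
    by (simp only: times_ereal.simps(1)[symmetric] mult_ac)
  also have "\<dots> = ereal (c K) * (ereal R * x 0)"
    unfolding PR by (simp only: times_ereal.simps(1)[symmetric] mult_ac)
  also have "ereal (c K) * S + \<dots> = ereal (c K) * (S + ereal R * x 0)"
    using S R x by (intro ereal_right_distrib[symmetric]) auto
  also have "S + ereal R * x 0 = (\<Sum>j\<in>{0..K}. ereal (\<Prod>i\<in>{j..<K}. c i * d i) * x j)"
    unfolding S_def R_def by (simp add: sum.atLeast_Suc_atMost add.commute)
  finally show ?thesis .
qed

section \<open>Iterated Stein equations\<close>

context stein_system
begin

text \<open>Membership in \<open>H k\<close>, centredness and smoothness are carried through the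
  induction because \<open>next_rhs\<close> and \<open>next_sol\<close> require them.
  Differentiability of \<open>r k\<close> needs that of the k-th derivative of the solution; the
  latter is itself distinguished, so \<open>smooth\<close> applies and regularity grows by one order
  per step.\<close>

lemma iterated_rhs:
  assumes T: "\<forall>j g x. enat j < N + 1 \<longrightarrow> times_differentiable (max 1 p) g \<longrightarrow>
      diff_op p (b j) g x = \<alpha> j * deriv g x"
    and smooth: "\<And>l g. enat l < N + 1 \<Longrightarrow> g \<in> H l \<Longrightarrow> centred (\<mu> l) g \<Longrightarrow>
      times_differentiable 1 (sol l g)"
    and h: "h \<in> H 0" "centred (\<mu> 0) h"
    and k: "enat k < N + 1" "times_differentiable k h"
  defines "r \<equiv> \<lambda>k x. (deriv ^^ k) h x + (\<Sum>i<k. \<alpha> i) * (deriv ^^ k) (sol 0 h) x"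
  shows "r k \<in> H k \<and> centred (\<mu> k) (r k) \<and> (deriv ^^ k) (sol 0 h) = sol k (r k) \<and>
    times_differentiable k (sol 0 h)"
  using k
proof (induction k)
  case 0
  then show ?case using h by (simp add: r_def times_differentiable_def)
next
  case (Suc k)
  let ?f = "sol 0 h"
  have lt: "enat k < N + 1" using Suc.prems(1) by (metis enat_ord_simps(2) lessI less_trans)
  have IH: "r k \<in> H k" "centred (\<mu> k) (r k)" "(deriv ^^ k) ?f = sol k (r k)"
    "times_differentiable k ?f"
    using Suc.IH[OF lt] Suc.prems(2) by (auto simp: times_differentiable_Suc)
  have f1: "times_differentiable 1 ((deriv ^^ k) ?f)"
    unfolding IH(3) by (rule smooth[OF lt IH(1,2)])
  have h1: "times_differentiable 1 ((deriv ^^ k) h)"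
    using Suc.prems(2) unfolding times_differentiable_one by (simp add: times_differentiable_Suc)
  have der: "(r k has_real_derivative
      (deriv ^^ Suc k) h x + (\<Sum>i<k. \<alpha> i) * (deriv ^^ Suc k) ?f x) (at x)" for x
    using f1 h1 unfolding r_def times_differentiable_one
    by (auto intro!: DERIV_add DERIV_cmult simp: DERIV_deriv_iff_field_differentiable)
  then have r1: "times_differentiable 1 (r k)"
    unfolding times_differentiable_one field_differentiable_def by blast
  \<comment> \<open>\<open>solves\<close> yields \<open>p\<close> derivatives, which for
    \<open>p = 0\<close> does not include the g' in T_k g = \<alpha>_k g'; \<open>smooth\<close>
    supplies it.\<close>
  have "times_differentiable (max 1 p) ((deriv ^^ k) ?f)"
    using f1 sol[OF lt IH(1,2)] unfolding IH(3) solves_def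
    by (intro times_differentiable_max) auto
  with T lt
  have "diff_op p (b k) ((deriv ^^ k) ?f) x = \<alpha> k * deriv ((deriv ^^ k) ?f) x" for x by blast
  \<comment> \<open>Differentiation keeps the coefficient summed over \<open>i < k\<close>, and T_k
    contributes \<open>\<alpha> k\<close>, which completes the sum over
    \<open>i < Suc k\<close>.\<close>
  then have "deriv (r k) x + diff_op p (b k) (sol k (r k)) x = r (Suc k) x" for x
    unfolding IH(3)[symmetric] DERIV_imp_deriv[OF der] by (simp add: r_def algebra_simps)
  then have eq: "(\<lambda>x. deriv (r k) x + diff_op p (b k) (sol k (r k)) x) = r (Suc k)"
    by blast
  have lt': "enat (k + 1) < N + 1" using Suc.prems(1) by simp
  show ?case
    using next_rhs[OF lt' IH(1,2) r1] next_sol[OF lt' IH(1,2) r1] IH f1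
    unfolding eq times_differentiable_one by (simp add: times_differentiable_Suc)
qed

text \<open>The order \<open>m\<close> is left general to cover both (i) and (ii);
  \<open>1 \<le> m\<close> gives the first derivative that the iteration requires. Only
  \<open>k\<close> derivatives of \<open>h\<close> enter, yet the solution gains one more.\<close>

lemma iterated_bound:
  assumes T: "\<forall>j g x. enat j < N + 1 \<longrightarrow> times_differentiable (max 1 p) g \<longrightarrow>
      diff_op p (b j) g x = \<alpha> j * deriv g x"
    and K: "solution_bound m N \<mu> H sol K" and m: "1 \<le> m"
    and h: "h \<in> H 0" "centred (\<mu> 0) h"
    and k: "enat k < N + 1" "times_differentiable k h"
  shows "times_differentiable (Suc k) (sol 0 h)"
    and "sup_norm ((deriv ^^ (k + m)) (sol 0 h)) \<le>
      ereal (K k) * (sup_norm ((deriv ^^ k) h)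
        + ereal \<bar>\<Sum>i<k. \<alpha> i\<bar> * sup_norm ((deriv ^^ k) (sol 0 h)))"
proof -
  let ?f = "sol 0 h"
  define r where "r = (\<lambda>x. (deriv ^^ k) h x + (\<Sum>i<k. \<alpha> i) * (deriv ^^ k) ?f x)"
  have K': "0 \<le> K l" if "enat l < N + 1" for l
    using K that unfolding solution_bound_def by blast
  have sm: "times_differentiable m (sol l g)"
    and bd: "sup_norm ((deriv ^^ m) (sol l g)) \<le> ereal (K l) * sup_norm g"
    if "enat l < N + 1" "g \<in> H l" "centred (\<mu> l) g" for l g
    using K that unfolding solution_bound_def by blast+
  have r: "r \<in> H k \<and> centred (\<mu> k) r \<and> (deriv ^^ k) ?f = sol k r \<and> times_differentiable k ?f"
    unfolding r_def
    using T times_differentiable_mono[OF sm m] h k by (rule iterated_rhs)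
  have "times_differentiable 1 (sol k r)"
    using times_differentiable_mono[OF sm m] k r by blast
  then show "times_differentiable (Suc k) ?f"
    using r unfolding times_differentiable_one by (simp add: times_differentiable_Suc)
  have "(deriv ^^ (k + m)) ?f = (deriv ^^ m) (sol k r)"
    using r by (simp add: add.commute[of k] funpow_add)
  then have "sup_norm ((deriv ^^ (k + m)) ?f) \<le> ereal (K k) * sup_norm r"
    using bd[OF k(1)] r by simp
  also have "\<dots> \<le> ereal (K k) * (sup_norm ((deriv ^^ k) h)
        + ereal \<bar>\<Sum>i<k. \<alpha> i\<bar> * sup_norm ((deriv ^^ k) ?f))"
    unfolding r_def by (intro ereal_mult_left_mono sup_norm_add_scaled) (use K' k in auto)
  finally show "sup_norm ((deriv ^^ (k + m)) ?f) \<le> \<dots>" .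
qed

end

section \<open>Bounds on the derivatives of the solution\<close>

theorem lemma2p4:
  fixes N :: enat
    and p n :: nat
    and \<mu> :: "nat \<Rightarrow> real measure"
    and a b :: "nat \<Rightarrow> nat \<Rightarrow> real \<Rightarrow> real"
    and F H :: "nat \<Rightarrow> (real \<Rightarrow> real) set"
    and sol :: "nat \<Rightarrow> (real \<Rightarrow> real) \<Rightarrow> real \<Rightarrow> real"
    and \<alpha> A :: "nat \<Rightarrow> real"
    and h f :: "real \<Rightarrow> real"
  assumes "stein_system N p \<mu> a b F H sol"
    and "\<And>j g x. enat j < N + 1 \<Longrightarrow> times_differentiable (max 1 p) g \<Longrightarrow>
           diff_op p (b j) g x = \<alpha> j * deriv g x"
    and "1 \<le> n" and "enat n < N + 1"
    and "h \<in> Cb n" and "h \<in> H 0" and "centred (\<mu> 0) h"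
    and "f = sol 0 h"
    and "\<And>j. enat j < N + 1 \<Longrightarrow> A j = \<bar>\<Sum>i\<le>j. \<alpha> i\<bar>"
  shows
    "(\<forall>C. solution_bound 1 N \<mu> H sol C \<longrightarrow>
        times_differentiable n f \<and>
        sup_norm ((deriv ^^ n) f) \<le>
          ereal (C (n - 1)) *
            (\<Sum>j\<in>{0..n - 1}. ereal (\<Prod>i\<in>{j..<n - 1}. C i * A i) * sup_norm ((deriv ^^ j) h)))
     \<and>
     (\<forall>D. solution_bound 2 N \<mu> H sol D \<longrightarrow>
        times_differentiable n f \<and>
        (\<forall>k. n = 2 * k + 1 \<longrightarrow>
           sup_norm ((deriv ^^ (2 * k + 1)) f) \<le>
             ereal (D (2 * k - 1)) *
               (\<Sum>j\<in>{1..k}. ereal (\<Prod>i\<in>{j..<k}. D (2 * i - 1) * A (2 * i)) *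
                  sup_norm ((deriv ^^ (2 * j - 1)) h))
             + sup_norm (deriv f) * ereal (\<Prod>i\<in>{1..k}. D (2 * i - 1) * A (2 * i - 2))) \<and>
        (\<forall>k. n = 2 * k \<longrightarrow>
           sup_norm ((deriv ^^ (2 * k)) f) \<le>
             ereal (D (2 * k - 2)) *
               (\<Sum>j\<in>{0..<k}. ereal (\<Prod>i\<in>{j..<k - 1}. D (2 * i) * A (2 * i + 1)) *
                  sup_norm ((deriv ^^ (2 * j)) h))))"
proof -
  interpret stein_system N p \<mu> a b F H sol by fact
  have T: "\<forall>j g x. enat j < N + 1 \<longrightarrow> times_differentiable (max 1 p) g \<longrightarrow>
      diff_op p (b j) g x = \<alpha> j * deriv g x" using assms(2) by blast
  have lt: "enat k < N + 1" if "k \<le> n" for k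
    using that \<open>enat n < N + 1\<close> by (meson enat_ord_simps(1) le_less_trans)
  \<comment> \<open>The n-th derivative of a function in \<open>Cb n\<close> may fail to exist at
    some points, so the iteration stops at level \<open>n - 1\<close>.\<close>
  have hd: "times_differentiable k h" if "k < n" for k
    using \<open>h \<in> Cb n\<close> that by (auto simp: Cb_def intro: times_differentiable_mono)
  have A: "A k = \<bar>\<Sum>i<Suc k. \<alpha> i\<bar>" "0 \<le> A k" if "k \<le> n" for k
    using assms(9)[OF lt[OF that]] by (simp_all add: lessThan_Suc_atMost)
  note bound = iterated_bound[OF T _ _ \<open>h \<in> H 0\<close> \<open>centred (\<mu> 0) h\<close> lt hd,
      folded \<open>f = sol 0 h\<close>]
  have smooth: "times_differentiable n f" if "solution_bound m N \<mu> H sol K" "1 \<le> m" for m K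
    using bound(1)[OF that, of "n - 1"] \<open>1 \<le> n\<close> by simp
  have nonneg: "0 \<le> K k" if "solution_bound m N \<mu> H sol K" "k \<le> n" for m K k
    using that lt unfolding solution_bound_def by blast
  \<comment> \<open>At level 0 the coefficient of the norm of \<open>f\<close> is an empty sum, and
    0 times that norm is 0 even if it is infinite.\<close>
  have base: "sup_norm ((deriv ^^ m) f) \<le> ereal (K 0) * sup_norm h"
    if "solution_bound m N \<mu> H sol K" "1 \<le> m" for m K
    using bound(2)[OF that, of 0] \<open>1 \<le> n\<close> by (simp flip: zero_ereal_def)
  \<comment> \<open>The sum over \<open>i < Suc k\<close> at level \<open>Suc k\<close> is the one
    in \<open>A k\<close>, hence the shift of index between \<open>K\<close> and
    \<open>A\<close>.\<close>
  have step: "sup_norm ((deriv ^^ (Suc k + m)) f) \<le>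
      ereal (K (Suc k)) * (sup_norm ((deriv ^^ Suc k) h) + ereal (A k) * sup_norm ((deriv ^^ Suc k) f))"
    if "solution_bound m N \<mu> H sol K" "1 \<le> m" "Suc k < n" for m K k
    using bound(2)[OF that(1,2), of "Suc k"] that(3) A(1)[of k] by simp
  show ?thesis
  proof (intro conjI allI impI)
    fix C assume C: "solution_bound 1 N \<mu> H sol C"
    show "times_differentiable n f" using smooth[OF C] by simp
    have "sup_norm ((deriv ^^ Suc (n - 1)) f) \<le> ereal (C (n - 1)) *
        (\<Sum>j\<in>{0..n - 1}. ereal (\<Prod>i\<in>{j..<n - 1}. C i * A i) * sup_norm ((deriv ^^ j) h))"
    proof (rule recursion_unroll_initial)
      show "sup_norm ((deriv ^^ Suc 0) f) \<le> ereal (C 0) * sup_norm ((deriv ^^ 0) h)"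
        using base[OF C] by simp
    next
      fix k assume "Suc k \<le> n - 1"
      then show "sup_norm ((deriv ^^ Suc (Suc k)) f) \<le> ereal (C (Suc k)) *
          (sup_norm ((deriv ^^ Suc k) h) + ereal (A k) * sup_norm ((deriv ^^ Suc k) f))"
        using step[OF C, of k] by simp
    qed (use nonneg[OF C] A sup_norm_nonneg in auto)
    then show "sup_norm ((deriv ^^ n) f) \<le> ereal (C (n - 1)) *
        (\<Sum>j\<in>{0..n - 1}. ereal (\<Prod>i\<in>{j..<n - 1}. C i * A i) * sup_norm ((deriv ^^ j) h))"
      using \<open>1 \<le> n\<close> by simp
  next
    fix D assume D: "solution_bound 2 N \<mu> H sol D"
    show "times_differentiable n f" using smooth[OF D] by simp
    {
      fix k assume n: "n = 2 * k + 1"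
      \<comment> \<open>The recursion runs over odd orders from f', using the levels
        \<open>2 * l + 1\<close>. For \<open>k = 0\<close> truncated subtraction makes
        \<open>D (2 * k - 1)\<close> equal to \<open>D 0\<close>, but this multiplies an empty
        sum.\<close>
      have "sup_norm ((deriv ^^ (2 * k + 1)) f) \<le> ereal (D (2 * k - 1)) *
          (\<Sum>j\<in>{1..k}. ereal (\<Prod>i\<in>{j..<k}. D (2 * i - 1) * A (2 * i)) *
            sup_norm ((deriv ^^ (2 * j - 1)) h))
        + sup_norm ((deriv ^^ (2 * 0 + 1)) f)
          * ereal (\<Prod>i\<in>{1..k}. D (2 * i - 1) * A (2 * (i - 1)))"
      proof (rule recursion_unroll)
        fix l assume "Suc l \<le> k"
        then show "sup_norm ((deriv ^^ (2 * Suc l + 1)) f) \<le> ereal (D (2 * Suc l - 1)) *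
            (sup_norm ((deriv ^^ (2 * Suc l - 1)) h)
              + ereal (A (2 * l)) * sup_norm ((deriv ^^ (2 * l + 1)) f))"
          using step[OF D, of "2 * l"] n by simp
      qed (use nonneg[OF D] A n sup_norm_nonneg in auto)
      then show "sup_norm ((deriv ^^ (2 * k + 1)) f) \<le> ereal (D (2 * k - 1)) *
          (\<Sum>j\<in>{1..k}. ereal (\<Prod>i\<in>{j..<k}. D (2 * i - 1) * A (2 * i)) *
            sup_norm ((deriv ^^ (2 * j - 1)) h))
        + sup_norm (deriv f) * ereal (\<Prod>i\<in>{1..k}. D (2 * i - 1) * A (2 * i - 2))"
        by (simp add: diff_mult_distrib2)
    }
    fix k assume n: "n = 2 * k"
    then obtain l where l: "k = Suc l" using \<open>1 \<le> n\<close> by (cases k) auto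
    \<comment> \<open>The recursion runs over even orders, using the levels \<open>2 * i\<close>,
      and starts from the bound on f'' by \<open>h\<close>. Writing \<open>k = Suc l\<close> removes
      the truncated subtractions.\<close>
    have "sup_norm ((deriv ^^ (2 * l + 2)) f) \<le> ereal (D (2 * l)) *
        (\<Sum>j\<in>{0..l}. ereal (\<Prod>i\<in>{j..<l}. D (2 * i) * A (2 * i + 1)) *
          sup_norm ((deriv ^^ (2 * j)) h))"
    proof (rule recursion_unroll_initial)
      show "sup_norm ((deriv ^^ (2 * 0 + 2)) f) \<le> ereal (D (2 * 0)) * sup_norm ((deriv ^^ (2 * 0)) h)"
        using base[OF D] by (simp add: numeral_2_eq_2)
    next
      fix i assume "Suc i \<le> l"
      then show "sup_norm ((deriv ^^ (2 * Suc i + 2)) f) \<le> ereal (D (2 * Suc i)) *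
          (sup_norm ((deriv ^^ (2 * Suc i)) h)
            + ereal (A (2 * i + 1)) * sup_norm ((deriv ^^ (2 * i + 2)) f))"
        using step[OF D, of "2 * i + 1"] n l by simp
    qed (use nonneg[OF D] A n l sup_norm_nonneg in auto)
    then show "sup_norm ((deriv ^^ (2 * k)) f) \<le> ereal (D (2 * k - 2)) *
        (\<Sum>j\<in>{0..<k}. ereal (\<Prod>i\<in>{j..<k - 1}. D (2 * i) * A (2 * i + 1)) *
          sup_norm ((deriv ^^ (2 * j)) h))"
      by (simp add: l atLeastLessThanSuc_atLeastAtMost)
  qed
qed

end
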